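(* Assume ${\rm GBC}^-$. Every well-founded class relation $\langle X,\vartriangleleft\rangle$ admits a ranking to some class well-order $\langle\Gamma,\leq_\Gamma\rangle$.
   Context: ${\rm GBC}^-$ is Gödel–Bernays set theory without the power set axiom and with global choice in the form of a class bijection between the universe $V$ and the class $\mathrm{Ord}$ of ordinals. A binary class relation $\vartriangleleft$ on a class $X$ is well-founded if every nonempty subset of $X$ has a $\vartriangleleft$-minimal element. A class well-order is a class linear order that is well-founded. A ranking of a relation $\vartriangleleft$ on $X$ by a class well-order $\langle\Gamma,\leq_\Gamma\rangle$ is a class map $\pi:X\to\Gamma$ such that $a\vartriangleleft b$ implies $\pi(a)<_\Gamma\pi(b)$. *)

theory Defs
  imports Main
begin

text \<open>
  A structure for two-sorted class theory consists of a type \<open>'s\<close> of sets, a membership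
  relation \<open>E\<close> on it, and a family \<open>Cls\<close> of subcollections of \<open>'s\<close>, the classes.  Both are
  arbitrary: \<open>E\<close> need not be well-founded in the sense of HOL, and \<open>Cls\<close> need not contain every
  HOL set.  Representing a class by its HOL set of members builds in extensionality for classes.
  The set \<open>x\<close> corresponds to the class \<open>{y. E y x}\<close>.
\<close>

text \<open>
  First-order formulas with class parameters: variables and quantifiers range over sets only.
  \<open>InClass i k\<close> says that set variable \<open>i\<close> belongs to class parameter \<open>k\<close>.
\<close>

datatype fm =
    Mem nat nat
  | Eq nat nat
  | InClass nat nat
  | Neg fm
  | Conj fm fm
  | All nat fm

primrec sat :: "('s \<Rightarrow> 's \<Rightarrow> bool) \<Rightarrow> (nat \<Rightarrow> 's set) \<Rightarrow> (nat \<Rightarrow> 's) \<Rightarrow> fm \<Rightarrow> bool" where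
  "sat E C e (Mem i j) \<longleftrightarrow> E (e i) (e j)"
| "sat E C e (Eq i j) \<longleftrightarrow> e i = e j"
| "sat E C e (InClass i k) \<longleftrightarrow> e i \<in> C k"
| "sat E C e (Neg \<phi>) \<longleftrightarrow> \<not> sat E C e \<phi>"
| "sat E C e (Conj \<phi> \<psi>) \<longleftrightarrow> sat E C e \<phi> \<and> sat E C e \<psi>"
| "sat E C e (All i \<phi>) \<longleftrightarrow> (\<forall>x. sat E C (e(i := x)) \<phi>)"

definition is_upair :: "('s \<Rightarrow> 's \<Rightarrow> bool) \<Rightarrow> 's \<Rightarrow> 's \<Rightarrow> 's \<Rightarrow> bool" where
  "is_upair E p a b \<longleftrightarrow> (\<forall>z. E z p \<longleftrightarrow> z = a \<or> z = b)"

text \<open>Kuratowski pairs: \<open>p = {{a}, {a, b}}\<close>.\<close>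

definition is_opair :: "('s \<Rightarrow> 's \<Rightarrow> bool) \<Rightarrow> 's \<Rightarrow> 's \<Rightarrow> 's \<Rightarrow> bool" where
  "is_opair E p a b \<longleftrightarrow> (\<exists>u v. is_upair E u a a \<and> is_upair E v a b \<and> is_upair E p u v)"

definition related :: "('s \<Rightarrow> 's \<Rightarrow> bool) \<Rightarrow> 's set \<Rightarrow> 's \<Rightarrow> 's \<Rightarrow> bool" where
  "related E R a b \<longleftrightarrow> (\<exists>p\<in>R. is_opair E p a b)"

definition within_product :: "('s \<Rightarrow> 's \<Rightarrow> bool) \<Rightarrow> 's set \<Rightarrow> 's set \<Rightarrow> 's set \<Rightarrow> bool" where
  "within_product E A B R \<longleftrightarrow> (\<forall>p\<in>R. \<exists>a\<in>A. \<exists>b\<in>B. is_opair E p a b)"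

definition class_map ::
  "('s \<Rightarrow> 's \<Rightarrow> bool) \<Rightarrow> 's set set \<Rightarrow> 's set \<Rightarrow> 's set \<Rightarrow> 's set \<Rightarrow> bool" where
  "class_map E Cls A B F \<longleftrightarrow>
     F \<in> Cls \<and> within_product E A B F \<and> (\<forall>a\<in>A. \<exists>!b. related E F a b)"

definition class_bijection ::
  "('s \<Rightarrow> 's \<Rightarrow> bool) \<Rightarrow> 's set set \<Rightarrow> 's set \<Rightarrow> 's set \<Rightarrow> 's set \<Rightarrow> bool" where
  "class_bijection E Cls A B F \<longleftrightarrow>
     class_map E Cls A B F \<and> (\<forall>b\<in>B. \<exists>!a. related E F a b)"

text \<open>
  The quantifier over \<open>s\<close> ranges over the sets of the structure, so this is neither
  well-foundedness in the sense of HOL nor a quantification over subclasses.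
\<close>

definition well_founded_on ::
  "('s \<Rightarrow> 's \<Rightarrow> bool) \<Rightarrow> 's set \<Rightarrow> ('s \<Rightarrow> 's \<Rightarrow> bool) \<Rightarrow> bool" where
  "well_founded_on E A r \<longleftrightarrow>
     (\<forall>s. (\<exists>x. E x s) \<and> (\<forall>x. E x s \<longrightarrow> x \<in> A) \<longrightarrow>
          (\<exists>m. E m s \<and> (\<forall>x. E x s \<longrightarrow> \<not> r x m)))"

definition is_ordinal :: "('s \<Rightarrow> 's \<Rightarrow> bool) \<Rightarrow> 's \<Rightarrow> bool" where
  "is_ordinal E x \<longleftrightarrow>
     (\<forall>y z. E y x \<and> E z y \<longrightarrow> E z x) \<and>
     irreflp_on {y. E y x} E \<and> transp_on {y. E y x} E \<and> totalp_on {y. E y x} E \<and>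
     well_founded_on E {y. E y x} E"

text \<open>
  Foundation is stated for classes, and replacement for partial class functions, so that it
  includes separation.  Together with global choice, replacement yields collection.
\<close>

locale GBC_minus =
  fixes E :: "'s \<Rightarrow> 's \<Rightarrow> bool" (infix \<open>\<epsilon>\<close> 50)
    and Cls :: "'s set set"
  assumes extensionality: "(\<And>z. z \<epsilon> x \<longleftrightarrow> z \<epsilon> y) \<Longrightarrow> x = y"
    and pairing: "\<exists>p. is_upair E p x y"
    and union: "\<exists>u. \<forall>z. z \<epsilon> u \<longleftrightarrow> (\<exists>y. y \<epsilon> x \<and> z \<epsilon> y)"
    and infinity:
      "\<exists>w. (\<exists>n. n \<epsilon> w \<and> (\<forall>z. \<not> z \<epsilon> n)) \<and>
           (\<forall>n. n \<epsilon> w \<longrightarrow> (\<exists>m. m \<epsilon> w \<and> (\<forall>z. z \<epsilon> m \<longleftrightarrow> z \<epsilon> n \<or> z = n)))"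
    and foundation: "A \<in> Cls \<Longrightarrow> A \<noteq> {} \<Longrightarrow> \<exists>m\<in>A. \<forall>x\<in>A. \<not> x \<epsilon> m"
    and replacement:
      "F \<in> Cls \<Longrightarrow> (\<And>a b c. related E F a b \<Longrightarrow> related E F a c \<Longrightarrow> b = c) \<Longrightarrow>
       \<exists>y. \<forall>b. b \<epsilon> y \<longleftrightarrow> (\<exists>a. a \<epsilon> x \<and> related E F a b)"
    and class_comprehension:
      "(\<And>k. C k \<in> Cls) \<Longrightarrow> {x. sat E C (e(i := x)) \<phi>} \<in> Cls"
    and global_choice: "\<exists>F. class_bijection E Cls UNIV {x. is_ordinal E x} F"

definition binary_class_relation ::
  "('s \<Rightarrow> 's \<Rightarrow> bool) \<Rightarrow> 's set set \<Rightarrow> 's set \<Rightarrow> 's set \<Rightarrow> bool" where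
  "binary_class_relation E Cls X R \<longleftrightarrow> X \<in> Cls \<and> R \<in> Cls \<and> within_product E X X R"

definition well_founded_class_relation ::
  "('s \<Rightarrow> 's \<Rightarrow> bool) \<Rightarrow> 's set set \<Rightarrow> 's set \<Rightarrow> 's set \<Rightarrow> bool" where
  "well_founded_class_relation E Cls X R \<longleftrightarrow>
     binary_class_relation E Cls X R \<and> well_founded_on E X (related E R)"

definition strictly_related :: "('s \<Rightarrow> 's \<Rightarrow> bool) \<Rightarrow> 's set \<Rightarrow> 's \<Rightarrow> 's \<Rightarrow> bool" where
  "strictly_related E L a b \<longleftrightarrow> related E L a b \<and> a \<noteq> b"

definition class_linear_order ::
  "('s \<Rightarrow> 's \<Rightarrow> bool) \<Rightarrow> 's set set \<Rightarrow> 's set \<Rightarrow> 's set \<Rightarrow> bool" where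
  "class_linear_order E Cls \<Gamma> L \<longleftrightarrow>
     binary_class_relation E Cls \<Gamma> L \<and>
     reflp_on \<Gamma> (related E L) \<and> antisymp_on \<Gamma> (related E L) \<and>
     transp_on \<Gamma> (related E L) \<and> totalp_on \<Gamma> (related E L)"

text \<open>The order is reflexive, so well-foundedness refers to its strict part.\<close>

definition class_well_order ::
  "('s \<Rightarrow> 's \<Rightarrow> bool) \<Rightarrow> 's set set \<Rightarrow> 's set \<Rightarrow> 's set \<Rightarrow> bool" where
  "class_well_order E Cls \<Gamma> L \<longleftrightarrow>
     class_linear_order E Cls \<Gamma> L \<and> well_founded_on E \<Gamma> (strictly_related E L)"

definition ranking ::
  "('s \<Rightarrow> 's \<Rightarrow> bool) \<Rightarrow> 's set set \<Rightarrow> 's set \<Rightarrow> 's set \<Rightarrow> 's set \<Rightarrow> 's set \<Rightarrow> 's set \<Rightarrow> bool" where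
  "ranking E Cls X R \<Gamma> L \<pi> \<longleftrightarrow>
     class_map E Cls X \<Gamma> \<pi> \<and>
     (\<forall>a b c d. related E R a b \<and> related E \<pi> a c \<and> related E \<pi> b d \<longrightarrow>
                strictly_related E L c d)"

end

theory Submission
  imports Defs
begin

text \<open>
  The relation has a linear extension that is a class well-order, so the identity is a ranking.
  Let \<open>\<unlhd>\<close> be the reflexive transitive closure of the relation and \<open>\<prec>\<close> the well-order of the universe
  given by global choice.  Attach to each \<open>x\<close> the sequence \<open>p\<^sub>0, p\<^sub>1, \<dots>, x\<close>, where \<open>p\<^sub>0\<close> is the
  \<open>\<prec>\<close>-first element above \<open>x\<close> and \<open>p\<^sub>i\<^sub>+\<^sub>1\<close> the \<open>\<prec>\<close>-first element above \<open>x\<close> and strictly below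
  \<open>p\<^sub>i\<close>.  It descends, hence ends at \<open>x\<close>.  Compare these sequences in the Kleene-Brouwer order.
  If \<open>q\<close> lies below \<open>p\<close>, then every candidate for \<open>p\<close> is one for \<open>q\<close>, so \<open>q\<close> precedes \<open>p\<close>.  The
  leftmost branch through a set without a first element would be a descending sequence without end.
\<close>

section \<open>Definable predicates\<close>

lemma sat_finite_support:
  "\<exists>n. \<forall>e e'. (\<forall>i<n. e i = e' i) \<longrightarrow> sat E C e \<phi> = sat E C e' \<phi>"
proof (induction \<phi>)
  case (Mem i j)
  show ?case by (rule exI[of _ "Suc (i + j)"]) auto
next
  case (Eq i j)
  show ?case by (rule exI[of _ "Suc (i + j)"]) auto
next
  case (InClass i k)
  show ?case by (rule exI[of _ "Suc i"]) auto
next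
  case (Neg \<phi>)
  then show ?case by (metis sat.simps(4))
next
  case (Conj \<phi> \<psi>)
  then obtain m n where
    "\<forall>e e'. (\<forall>i<m. e i = e' i) \<longrightarrow> sat E C e \<phi> = sat E C e' \<phi>"
    "\<forall>e e'. (\<forall>i<n. e i = e' i) \<longrightarrow> sat E C e \<psi> = sat E C e' \<psi>"
    by blast
  then show ?case
    by (metis sat.simps(5) less_max_iff_disj)
next
  case (All j \<phi>)
  then obtain n where n: "\<forall>e e'. (\<forall>i<n. e i = e' i) \<longrightarrow> sat E C e \<phi> = sat E C e' \<phi>"
    by blast
  have "sat E C (e(j := x)) \<phi> = sat E C (e'(j := x)) \<phi>" if "\<forall>i<n. e i = e' i" for e e' x
    using n[rule_format, of "e(j := x)" "e'(j := x)"] that by simp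
  then show ?case unfolding sat.simps by metis
qed

text \<open>\<open>f\<close> need not be injective, so renaming could capture a bound variable. The
  induction ranges over all \<open>f\<close>, so that the bound variable can be redirected to a
  fresh one.\<close>

lemma sat_rename: "\<exists>\<psi>. \<forall>e. sat E C e \<psi> = sat E C (\<lambda>k. e (f k)) \<phi>"
proof (induction \<phi> arbitrary: f)
  case (Mem i j)
  show ?case by (rule exI[of _ "Mem (f i) (f j)"]) simp
next
  case (Eq i j)
  show ?case by (rule exI[of _ "Eq (f i) (f j)"]) simp
next
  case (InClass i k)
  show ?case by (rule exI[of _ "InClass (f i) k"]) simp
next
  case (Neg \<phi>)
  then show ?case by (metis sat.simps(4))
next
  case (Conj \<phi> \<psi>)
  then show ?case by (metis sat.simps(5))
next
  case (All i \<phi>)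
  obtain n where n: "\<forall>e e'. (\<forall>i<n. e i = e' i) \<longrightarrow> sat E C e \<phi> = sat E C e' \<phi>"
    using sat_finite_support by blast
  \<comment> \<open>The body depends only on variables below \<open>n\<close>, so avoiding their
    finitely many images suffices.\<close>
  obtain j where j: "j \<notin> f ` {..<n}"
    using ex_new_if_finite[of "f ` {..<n}"] by auto
  obtain \<psi> where \<psi>: "\<forall>e. sat E C e \<psi> = sat E C (\<lambda>k. e ((f(i := j)) k)) \<phi>"
    using All by blast
  have "sat E C (e(j := x)) \<psi> = sat E C ((\<lambda>k. e (f k))(i := x)) \<phi>" for e x
  proof -
    have "sat E C (e(j := x)) \<psi> = sat E C (\<lambda>k. (e(j := x)) ((f(i := j)) k)) \<phi>"
      using \<psi> by blast
    also have "\<dots> = sat E C ((\<lambda>k. e (f k))(i := x)) \<phi>"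
    proof (rule n[rule_format])
      fix k assume "k < n"
      with j have "f k \<noteq> j" by auto
      then show "(e(j := x)) ((f(i := j)) k) = ((\<lambda>k. e (f k))(i := x)) k" by simp
    qed
    finally show ?thesis .
  qed
  then show ?case by (intro exI[of _ "All j \<psi>"]) simp
qed

text \<open>Serves to merge the parameter families of two formulas into a single family.\<close>

lemma sat_reindex:
  assumes "\<And>k. C' (h k) = C k"
  shows "\<exists>\<psi>. \<forall>e. sat E C' e \<psi> = sat E C e \<phi>"
proof (induction \<phi>)
  case (Mem i j)
  show ?case by (rule exI[of _ "Mem i j"]) simp
next
  case (Eq i j)
  show ?case by (rule exI[of _ "Eq i j"]) simp
next
  case (InClass i k)
  show ?case by (rule exI[of _ "InClass i (h k)"]) (simp add: assms)
next
  case (Neg \<phi>)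
  then show ?case by (metis sat.simps(4))
next
  case (Conj \<phi> \<psi>)
  then show ?case by (metis sat.simps(5))
next
  case (All i \<phi>)
  then show ?case by (metis sat.simps(6))
qed

definition set_term :: "((nat \<Rightarrow> 's) \<Rightarrow> 's) \<Rightarrow> bool" where
  "set_term t \<longleftrightarrow> (\<exists>i. t = (\<lambda>e. e i)) \<or> (\<exists>a. t = (\<lambda>e. a))"

lemma set_term_var: "set_term (\<lambda>e. e i)"
  by (auto simp: set_term_def)

lemma set_term_const: "set_term (\<lambda>e. a)"
  by (auto simp: set_term_def)

lemma set_term_shift: "set_term t \<Longrightarrow> set_term (\<lambda>e. t (\<lambda>k. e (Suc k)))"
  by (auto simp: set_term_def)

lemma set_term_cases:
  assumes "set_term t" "\<And>i. P (\<lambda>e. e i)" "\<And>a. P (\<lambda>e. a)"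
  shows "P t"
  using assms by (auto simp: set_term_def)

definition graph_class :: "('s \<Rightarrow> 's \<Rightarrow> bool) \<Rightarrow> ('s \<Rightarrow> 's \<Rightarrow> bool) \<Rightarrow> 's set" where
  "graph_class E Q = {p. \<exists>a b. is_opair E p a b \<and> Q a b}"

context GBC_minus
begin

text \<open>Agreement with the formula is demanded in every environment, so the environment cannot
  carry set parameters. These enter through singleton classes instead.\<close>

definition definable :: "((nat \<Rightarrow> 's) \<Rightarrow> bool) \<Rightarrow> bool" where
  "definable P \<longleftrightarrow> (\<exists>C \<phi>. (\<forall>k. C k \<in> Cls) \<and> (\<forall>e. sat E C e \<phi> = P e))"

lemma Cls_nonempty: "\<exists>A. A \<in> Cls"
  using global_choice by (auto simp: class_bijection_def class_map_def)

lemma definable_class: "definable (\<lambda>e. P (e 0)) \<Longrightarrow> {x. P x} \<in> Cls"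
proof -
  assume "definable (\<lambda>e. P (e 0))"
  then obtain C \<phi> where "\<forall>k. C k \<in> Cls" and \<phi>: "\<forall>e. sat E C e \<phi> = P (e 0)"
    by (auto simp: definable_def)
  then have "{x. sat E C (undefined(0 := x)) \<phi>} \<in> Cls"
    using class_comprehension by blast
  then show ?thesis by (simp add: \<phi>)
qed

lemma singleton_class: "{a} \<in> Cls"
proof -
  obtain A where "A \<in> Cls" using Cls_nonempty by blast
  then have "{x. sat E (\<lambda>_. A) ((\<lambda>_. a)(0 := x)) (Eq 0 1)} \<in> Cls"
    by (rule class_comprehension)
  then show ?thesis by simp
qed

lemma definable_rename: "definable P \<Longrightarrow> definable (\<lambda>e. P (\<lambda>k. e (f k)))"
  unfolding definable_def by (metis sat_rename)

section \<open>Closure of definability under connectives, quantifiers and substitution\<close>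

lemma definable_neg: "definable P \<Longrightarrow> definable (\<lambda>e. \<not> P e)"
  unfolding definable_def by (metis sat.simps(4))

lemma definable_conj:
  assumes "definable P" "definable Q"
  shows "definable (\<lambda>e. P e \<and> Q e)"
proof -
  obtain C D \<phi> \<psi> where C: "\<forall>k. C k \<in> Cls" "\<forall>e. sat E C e \<phi> = P e"
    and D: "\<forall>k. D k \<in> Cls" "\<forall>e. sat E D e \<psi> = Q e"
    using assms by (auto simp: definable_def)
  \<comment> \<open>The parameters of the first formula go to the even positions, those of the
    second to the odd ones.\<close>
  define B where "B k = (if even k then C (k div 2) else D (k div 2))" for k
  obtain \<phi>' where "\<forall>e. sat E B e \<phi>' = sat E C e \<phi>"
    using sat_reindex[of B "\<lambda>k. 2 * k" C E \<phi>] by (auto simp: B_def)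
  moreover obtain \<psi>' where "\<forall>e. sat E B e \<psi>' = sat E D e \<psi>"
    using sat_reindex[of B "\<lambda>k. 2 * k + 1" D E \<psi>] by (auto simp: B_def)
  ultimately have "\<forall>e. sat E B e (Conj \<phi>' \<psi>') = (P e \<and> Q e)"
    using C D by simp
  moreover have "\<forall>k. B k \<in> Cls" using C D by (simp add: B_def)
  ultimately show ?thesis unfolding definable_def by blast
qed

text \<open>The bound variable becomes variable \<open>0\<close> and the others are shifted, so that no
  freshness condition arises.\<close>

lemma definable_all:
  assumes "definable (\<lambda>e. Q (e 0) (\<lambda>k. e (Suc k)))"
  shows "definable (\<lambda>e. \<forall>x. Q x e)"
proof -
  obtain C \<phi> where C: "\<forall>k. C k \<in> Cls" "\<forall>e. sat E C e \<phi> = Q (e 0) (\<lambda>k. e (Suc k))"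
    using assms by (auto simp: definable_def)
  then have "\<forall>e. sat E C e (All 0 \<phi>) = (\<forall>x. Q x (\<lambda>k. e (Suc k)))"
    by simp
  with C have "definable (\<lambda>e. \<forall>x. Q x (\<lambda>k. e (Suc k)))"
    unfolding definable_def by blast
  \<comment> \<open>The predecessor map undoes the shift, since
    \<open>Suc k - 1 = k\<close>.\<close>
  from definable_rename[OF this, of "\<lambda>k. k - 1"] show ?thesis by simp
qed

lemma definable_disj:
  assumes "definable P" "definable Q"
  shows "definable (\<lambda>e. P e \<or> Q e)"
proof -
  have "definable (\<lambda>e. \<not> (\<not> P e \<and> \<not> Q e))"
    by (intro definable_neg definable_conj assms)
  then show ?thesis by simp
qed

lemma definable_imp:
  assumes "definable P" "definable Q"
  shows "definable (\<lambda>e. P e \<longrightarrow> Q e)"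
proof -
  have "definable (\<lambda>e. \<not> P e \<or> Q e)"
    by (intro definable_neg definable_disj assms)
  then show ?thesis by (simp only: imp_conv_disj)
qed

lemma definable_iff:
  assumes "definable P" "definable Q"
  shows "definable (\<lambda>e. P e \<longleftrightarrow> Q e)"
proof -
  have "definable (\<lambda>e. (P e \<longrightarrow> Q e) \<and> (Q e \<longrightarrow> P e))"
    by (intro definable_conj definable_imp assms)
  then show ?thesis by (simp only: iff_conv_conj_imp)
qed

lemma definable_ex:
  assumes "definable (\<lambda>e. Q (e 0) (\<lambda>k. e (Suc k)))"
  shows "definable (\<lambda>e. \<exists>x. Q x e)"
proof -
  have "definable (\<lambda>e. \<not> (\<forall>x. \<not> Q x e))"
    by (intro definable_neg definable_all assms)
  then show ?thesis by simp
qed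

lemma definable_atom: "definable (\<lambda>e. e i \<epsilon> e j)" "definable (\<lambda>e. e i = e j)"
  "A \<in> Cls \<Longrightarrow> definable (\<lambda>e. e i \<in> A)"
proof -
  obtain B where B: "B \<in> Cls" using Cls_nonempty by blast
  show "definable (\<lambda>e. e i \<epsilon> e j)" unfolding definable_def
    by (rule exI[of _ "\<lambda>_. B"], rule exI[of _ "Mem i j"]) (simp add: B)
  show "definable (\<lambda>e. e i = e j)" unfolding definable_def
    by (rule exI[of _ "\<lambda>_. B"], rule exI[of _ "Eq i j"]) (simp add: B)
  show "definable (\<lambda>e. e i \<in> A)" if "A \<in> Cls" unfolding definable_def
    by (rule exI[of _ "\<lambda>_. A"], rule exI[of _ "InClass i 0"]) (simp add: that)
qed

lemma definable_eq_var:
  assumes "set_term t"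
  shows "definable (\<lambda>e. e i = t e)"
  using assms
proof (rule set_term_cases)
  show "definable (\<lambda>e. e i = e j)" for j by (rule definable_atom)
  show "definable (\<lambda>e. e i = a)" for a
    using definable_atom(3)[OF singleton_class[of a], of i] by simp
qed

text \<open>Quantifying over a new variable equal to the term avoids any substitution inside
  \<open>Q\<close>.\<close>

lemma definable_subst1:
  assumes "definable (\<lambda>e. Q (e 0))" "set_term s"
  shows "definable (\<lambda>e. Q (s e))"
proof -
  have "definable (\<lambda>e. \<exists>x. x = s e \<and> Q x)"
    by (intro definable_ex definable_conj definable_eq_var set_term_shift assms)
  then show ?thesis by simp
qed

lemma definable_subst2:
  assumes "definable (\<lambda>e. Q (e 0) (e (Suc 0)))" "set_term s" "set_term t"
  shows "definable (\<lambda>e. Q (s e) (t e))"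
proof -
  have "definable (\<lambda>e. \<exists>y. y = t e \<and> (\<exists>x. x = s e \<and> Q x y))"
    by (intro definable_ex definable_conj definable_eq_var set_term_shift assms)
  then show ?thesis by simp
qed

lemma definable_subst3:
  assumes "definable (\<lambda>e. Q (e 0) (e (Suc 0)) (e (Suc (Suc 0))))"
    "set_term s" "set_term t" "set_term u"
  shows "definable (\<lambda>e. Q (s e) (t e) (u e))"
proof -
  have "definable (\<lambda>e. \<exists>z. z = u e \<and> (\<exists>y. y = t e \<and> (\<exists>x. x = s e \<and> Q x y z)))"
    by (intro definable_ex definable_conj definable_eq_var assms(1))
      (fact set_term_shift[OF assms(4)] set_term_shift[OF set_term_shift, OF assms(3)]
        set_term_shift[OF set_term_shift[OF set_term_shift, OF assms(2)]])+
  then show ?thesis by simp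
qed

lemmas definable_mem = definable_subst2[where Q = "\<lambda>x y. x \<epsilon> y", OF definable_atom(1)]
lemmas definable_eq = definable_subst2[where Q = "\<lambda>x y. x = y", OF definable_atom(2)]
lemmas definable_in_class = definable_subst1[where Q = "\<lambda>x. x \<in> A" for A, OF definable_atom(3)]

lemmas definable_intros =
  set_term_var set_term_const definable_neg definable_conj definable_disj definable_imp
  definable_iff definable_all definable_ex definable_mem definable_eq definable_in_class

lemma definable_upair:
  "set_term s \<Longrightarrow> set_term t \<Longrightarrow> set_term u \<Longrightarrow> definable (\<lambda>e. is_upair E (s e) (t e) (u e))"
  by (rule definable_subst3[where Q = "is_upair E"])
    (unfold is_upair_def, (intro definable_intros)+)

lemma definable_opair:
  "set_term s \<Longrightarrow> set_term t \<Longrightarrow> set_term u \<Longrightarrow> definable (\<lambda>e. is_opair E (s e) (t e) (u e))"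
  by (rule definable_subst3[where Q = "is_opair E"])
    (unfold is_opair_def, (intro definable_intros definable_upair)+)

lemma definable_related:
  assumes "A \<in> Cls" "set_term s" "set_term t"
  shows "definable (\<lambda>e. related E A (s e) (t e))"
  by (rule definable_subst2[OF _ assms(2,3), where Q = "related E A"])
    (unfold related_def Bex_def, intro definable_intros definable_opair assms)

section \<open>Sets and pairs\<close>

lemma upair_ex: "\<exists>p. \<forall>z. z \<epsilon> p \<longleftrightarrow> z = a \<or> z = b"
  using pairing by (simp add: is_upair_def)

lemma upair_inject:
  "is_upair E p a b \<Longrightarrow> is_upair E p c d \<Longrightarrow> a = c \<and> b = d \<or> a = d \<and> b = c"
  unfolding is_upair_def by metis

lemma opair_ex: "\<exists>p. is_opair E p a b"
  unfolding is_opair_def using pairing by metis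

lemma opair_inject:
  assumes "is_opair E p a b" "is_opair E p c d"
  shows "a = c \<and> b = d"
proof -
  obtain u v where u: "is_upair E u a a" "is_upair E v a b" "is_upair E p u v"
    using assms(1) by (auto simp: is_opair_def)
  obtain u' v' where u': "is_upair E u' c c" "is_upair E v' c d" "is_upair E p u' v'"
    using assms(2) by (auto simp: is_opair_def)
  have "u = u' \<and> v = v' \<or> u = v' \<and> v = u'"
    using upair_inject u(3) u'(3) by blast
  then show ?thesis
    using upair_inject u u' by metis
qed

lemma related_graph_class [simp]: "related E (graph_class E Q) a b \<longleftrightarrow> Q a b"
  unfolding related_def graph_class_def using opair_ex[of a b] opair_inject by blast

lemma graph_class_in_Cls:
  assumes "definable (\<lambda>e. Q (e 0) (e (Suc 0)))"
  shows "graph_class E Q \<in> Cls"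
  unfolding graph_class_def
  by (intro definable_class definable_intros definable_opair definable_subst2[of Q, OF assms])

lemma replacement_definable:
  assumes "definable (\<lambda>e. Q (e 0) (e (Suc 0)))" "\<And>a b c. Q a b \<Longrightarrow> Q a c \<Longrightarrow> b = c"
  shows "\<exists>y. \<forall>b. b \<epsilon> y \<longleftrightarrow> (\<exists>a. a \<epsilon> x \<and> Q a b)"
  using replacement[OF graph_class_in_Cls[of Q], of x] assms by simp

text \<open>Replacement along the identity restricted to \<open>P\<close>.\<close>

lemma separation:
  assumes "definable (\<lambda>e. P (e 0))"
  shows "\<exists>y. \<forall>z. z \<epsilon> y \<longleftrightarrow> z \<epsilon> x \<and> P z"
proof -
  have "\<exists>y. \<forall>b. b \<epsilon> y \<longleftrightarrow> (\<exists>a. a \<epsilon> x \<and> a = b \<and> P a)"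
    by (rule replacement_definable)
      (intro definable_intros definable_subst1[of P, OF assms], auto)
  then show ?thesis by auto
qed

lemma union2: "\<exists>u. \<forall>z. z \<epsilon> u \<longleftrightarrow> z \<epsilon> x \<or> z \<epsilon> y"
  using union upair_ex[of x y] by metis

lemma insert_ex: "\<exists>u. \<forall>z. z \<epsilon> u \<longleftrightarrow> z = a \<or> z \<epsilon> x"
  using union2 upair_ex[of a a] by metis

lemma foundation_definable:
  assumes "definable (\<lambda>e. P (e 0))" "P a"
  shows "\<exists>m. P m \<and> (\<forall>x. P x \<longrightarrow> \<not> x \<epsilon> m)"
  using foundation[OF definable_class[of P]] assms by auto

lemma not_mem_self: "\<not> a \<epsilon> a"
proof -
  have "definable (\<lambda>e. e 0 = a)" by (intro definable_intros)
  from foundation_definable[OF this] show ?thesis by blast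
qed

section \<open>The well-order given by global choice\<close>

text \<open>Otherwise the least element \<open>m\<close> of \<alpha> outside \<open>g\<close> has
  exactly the elements of \<open>g\<close>.\<close>

lemma transitive_subset_ordinal:
  assumes "is_ordinal E \<alpha>" "\<And>z. z \<epsilon> g \<Longrightarrow> z \<epsilon> \<alpha>" "\<And>y z. y \<epsilon> g \<Longrightarrow> z \<epsilon> y \<Longrightarrow> z \<epsilon> g"
  shows "g = \<alpha> \<or> g \<epsilon> \<alpha>"
proof (cases "g = \<alpha>")
  case False
  then obtain a where "a \<epsilon> \<alpha> \<and> \<not> a \<epsilon> g"
    using assms(2) extensionality by blast
  moreover have "definable (\<lambda>e. e 0 \<epsilon> \<alpha> \<and> \<not> e 0 \<epsilon> g)"
    by (intro definable_intros)
  ultimately obtain m where m: "m \<epsilon> \<alpha>" "\<not> m \<epsilon> g" "\<And>x. x \<epsilon> \<alpha> \<and> \<not> x \<epsilon> g \<Longrightarrow> \<not> x \<epsilon> m"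
    using foundation_definable[of "\<lambda>x. x \<epsilon> \<alpha> \<and> \<not> x \<epsilon> g"] by blast
  have trans: "\<And>y z. y \<epsilon> \<alpha> \<Longrightarrow> z \<epsilon> y \<Longrightarrow> z \<epsilon> \<alpha>"
    and total: "\<And>y z. y \<epsilon> \<alpha> \<Longrightarrow> z \<epsilon> \<alpha> \<Longrightarrow> y = z \<or> y \<epsilon> z \<or> z \<epsilon> y"
    using assms(1) by (auto simp: is_ordinal_def totalp_on_def)
  have "m = g"
  proof (rule extensionality)
    fix z
    show "z \<epsilon> m \<longleftrightarrow> z \<epsilon> g"
      using m trans total assms(2,3) by metis
  qed
  with m show ?thesis by simp
qed simp

text \<open>The intersection is a transitive subset of both. If it differed from both, it would be
  an element of both and hence of itself.\<close>

lemma ordinal_total: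
  assumes "is_ordinal E \<alpha>" "is_ordinal E \<beta>"
  shows "\<alpha> = \<beta> \<or> \<alpha> \<epsilon> \<beta> \<or> \<beta> \<epsilon> \<alpha>"
proof -
  have "definable (\<lambda>e. e 0 \<epsilon> \<beta>)" by (intro definable_intros)
  then obtain g where g: "\<And>z. z \<epsilon> g \<longleftrightarrow> z \<epsilon> \<alpha> \<and> z \<epsilon> \<beta>"
    using separation[of "\<lambda>z. z \<epsilon> \<beta>" \<alpha>] by blast
  have "z \<epsilon> g" if "y \<epsilon> g" "z \<epsilon> y" for y z
    using that g assms unfolding is_ordinal_def by blast
  then have "g = \<alpha> \<or> g \<epsilon> \<alpha>" "g = \<beta> \<or> g \<epsilon> \<beta>"
    using transitive_subset_ordinal assms g by blast+
  then show ?thesis using g not_mem_self by blast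
qed

end

locale GBC_enumeration = GBC_minus +
  fixes F
  assumes enumeration: "class_bijection E Cls UNIV {x. is_ordinal E x} F"
begin

definition prec :: "'a \<Rightarrow> 'a \<Rightarrow> bool" (infix \<open>\<prec>\<close> 50) where
  "x \<prec> y \<longleftrightarrow> (\<exists>a b. related E F x a \<and> related E F y b \<and> a \<epsilon> b)"

lemma F_class: "F \<in> Cls"
  using enumeration by (simp add: class_bijection_def class_map_def)

lemma index_ex: "\<exists>a. related E F x a"
  using enumeration by (auto simp: class_bijection_def class_map_def)

lemma index_ordinal:
  assumes "related E F x a"
  shows "is_ordinal E a"
proof -
  obtain p where p: "p \<in> F" "is_opair E p x a" using assms by (auto simp: related_def)
  then obtain c b where "is_ordinal E b" "is_opair E p c b"
    using enumeration
    by (fastforce simp: class_bijection_def class_map_def within_product_def)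
  then show ?thesis using p opair_inject by blast
qed

lemma index_unique: "related E F x a \<Longrightarrow> related E F x b \<Longrightarrow> a = b"
  using enumeration by (auto simp: class_bijection_def class_map_def)

lemma index_inject: "related E F x a \<Longrightarrow> related E F y a \<Longrightarrow> x = y"
  using enumeration index_ordinal unfolding class_bijection_def by blast

lemma definable_prec: "set_term s \<Longrightarrow> set_term t \<Longrightarrow> definable (\<lambda>e. s e \<prec> t e)"
  by (rule definable_subst2[where Q = "(\<prec>)"])
    (unfold prec_def, (intro definable_intros definable_related F_class)+)

lemma prec_irrefl: "\<not> x \<prec> x"
  using prec_def index_unique not_mem_self by metis

lemma prec_trans: "x \<prec> y \<Longrightarrow> y \<prec> z \<Longrightarrow> x \<prec> z"
  unfolding prec_def using index_ordinal index_unique is_ordinal_def by metis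

lemma prec_total: "x = y \<or> x \<prec> y \<or> y \<prec> x"
  unfolding prec_def using index_ex index_inject index_ordinal ordinal_total by metis

text \<open>Foundation for classes, applied to the indices of the elements satisfying
  \<open>P\<close>.\<close>

lemma prec_least:
  assumes "definable (\<lambda>e. P (e 0))" "P a"
  shows "\<exists>m. P m \<and> (\<forall>x. P x \<longrightarrow> \<not> x \<prec> m)"
proof -
  have "definable (\<lambda>e. \<exists>x. P x \<and> related E F x (e 0))"
    by (intro definable_intros definable_subst1[of P, OF assms(1)] definable_related F_class)
  moreover obtain c where "P a \<and> related E F a c" using assms(2) index_ex by blast
  ultimately obtain b m where "P m" "related E F m b"
    "\<And>c x. P x \<Longrightarrow> related E F x c \<Longrightarrow> \<not> c \<epsilon> b"
    using foundation_definable[of "\<lambda>b. \<exists>x. P x \<and> related E F x b"] by blast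
  then show ?thesis unfolding prec_def using index_unique by metis
qed

text \<open>The elements of the index of \<open>x\<close>, an ordinal, are pulled back along
  \<open>F\<close> by replacement.\<close>

lemma prec_predecessors_set: "\<exists>u. \<forall>y. y \<epsilon> u \<longleftrightarrow> y \<prec> x"
proof -
  obtain a where a: "related E F x a" using index_ex by blast
  have "\<exists>u. \<forall>y. y \<epsilon> u \<longleftrightarrow> (\<exists>b. b \<epsilon> a \<and> related E F y b)"
    using index_inject
    by (intro replacement_definable definable_intros definable_related F_class)
  then show ?thesis unfolding prec_def using a index_unique by metis
qed

text \<open>Replacement applied to the \<open>\<prec>\<close>-least witnesses.\<close>

lemma collection:
  assumes "definable (\<lambda>e. Q (e 0) (e (Suc 0)))"
  shows "\<exists>u. \<forall>a. a \<epsilon> x \<longrightarrow> (\<exists>y. Q a y) \<longrightarrow> (\<exists>y. y \<epsilon> u \<and> Q a y)"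
proof -
  let ?L = "\<lambda>a y. Q a y \<and> (\<forall>z. Q a z \<longrightarrow> \<not> z \<prec> y)"
  have "definable (\<lambda>e. ?L (e 0) (e (Suc 0)))"
    by (intro definable_intros definable_prec definable_subst2[of Q, OF assms])
  moreover have "y = z" if "?L a y" "?L a z" for a y z
    using that prec_total by blast
  ultimately obtain u where u: "\<And>b. b \<epsilon> u \<longleftrightarrow> (\<exists>a. a \<epsilon> x \<and> ?L a b)"
    using replacement_definable[of ?L x] by blast
  have "\<exists>y. ?L a y" if "Q a b" for a b
  proof -
    have "definable (\<lambda>e. Q a (e 0))"
      by (intro definable_subst2[of Q, OF assms] definable_intros)
    then show ?thesis using prec_least[of "Q a"] that by blast
  qed
  then show ?thesis using u by metis
qed

end

section \<open>The reflexive transitive closure of a class relation\<close>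

locale GBC_relation = GBC_enumeration +
  fixes X R
  assumes wf_relation: "well_founded_class_relation E Cls X R"
begin

abbreviation rel :: "'a \<Rightarrow> 'a \<Rightarrow> bool" (infix \<open>\<lhd>\<close> 50) where
  "a \<lhd> b \<equiv> related E R a b"

text \<open>\<open>q\<close> is reachable from \<open>p\<close> by descending through members of \<open>s\<close>.  Quantifying over closed
  sets avoids finite sequences and hence the internal natural numbers.\<close>

definition reaches_in :: "'a \<Rightarrow> 'a \<Rightarrow> 'a \<Rightarrow> bool" where
  "reaches_in s q p \<longleftrightarrow>
     (\<forall>t. p \<epsilon> t \<and> (\<forall>a b. b \<epsilon> t \<and> a \<epsilon> s \<and> a \<lhd> b \<longrightarrow> a \<epsilon> t) \<longrightarrow> q \<epsilon> t)"

text \<open>The predecessors of an element may form a proper class, so sets closed under all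
  predecessors may fail to exist and quantifying over them would be vacuous. Therefore closure is
  required only within some set \<open>s\<close>.\<close>

definition le :: "'a \<Rightarrow> 'a \<Rightarrow> bool" (infix \<open>\<unlhd>\<close> 50) where
  "q \<unlhd> p \<longleftrightarrow> (\<exists>s. reaches_in s q p)"

definition lt :: "'a \<Rightarrow> 'a \<Rightarrow> bool" (infix \<open>\<sqsubset>\<close> 50) where
  "q \<sqsubset> p \<longleftrightarrow> q \<unlhd> p \<and> q \<noteq> p"

lemma X_class: "X \<in> Cls" and R_class: "R \<in> Cls"
  using wf_relation
  by (auto simp: well_founded_class_relation_def binary_class_relation_def)

lemma rel_in_X: "a \<lhd> b \<Longrightarrow> a \<in> X \<and> b \<in> X"
proof -
  assume "a \<lhd> b"
  then obtain p where p: "p \<in> R" "is_opair E p a b" by (auto simp: related_def)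
  then obtain c d where "c \<in> X" "d \<in> X" "is_opair E p c d"
    using wf_relation
    by (auto simp: well_founded_class_relation_def binary_class_relation_def within_product_def)
  then show ?thesis using p opair_inject by blast
qed

lemma definable_rel: "set_term s \<Longrightarrow> set_term t \<Longrightarrow> definable (\<lambda>e. s e \<lhd> t e)"
  by (rule definable_related[OF R_class])

lemma definable_reaches_in:
  "set_term s \<Longrightarrow> set_term t \<Longrightarrow> set_term u \<Longrightarrow> definable (\<lambda>e. reaches_in (s e) (t e) (u e))"
  by (rule definable_subst3[where Q = reaches_in])
    (unfold reaches_in_def, (intro definable_intros definable_rel)+)

lemma definable_le: "set_term s \<Longrightarrow> set_term t \<Longrightarrow> definable (\<lambda>e. s e \<unlhd> t e)"
  by (rule definable_subst2[where Q = "(\<unlhd>)"])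
    (unfold le_def, (intro definable_intros definable_reaches_in)+)

lemma definable_lt: "set_term s \<Longrightarrow> set_term t \<Longrightarrow> definable (\<lambda>e. s e \<sqsubset> t e)"
  by (rule definable_subst2[where Q = "(\<sqsubset>)"])
    (unfold lt_def, (intro definable_intros definable_le)+)

lemma reaches_in_mono: "reaches_in s q p \<Longrightarrow> (\<And>z. z \<epsilon> s \<Longrightarrow> z \<epsilon> s') \<Longrightarrow> reaches_in s' q p"
  unfolding reaches_in_def by blast

lemma reaches_in_refl: "reaches_in s p p"
  unfolding reaches_in_def by blast

lemma reaches_in_trans: "reaches_in s r q \<Longrightarrow> reaches_in s q p \<Longrightarrow> reaches_in s r p"
  unfolding reaches_in_def by blast

lemma reaches_in_step: "a \<epsilon> s \<Longrightarrow> a \<lhd> b \<Longrightarrow> reaches_in s a b"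
  unfolding reaches_in_def by blast

lemma le_refl: "p \<unlhd> p"
  unfolding le_def using reaches_in_refl by blast

lemma le_trans:
  assumes "r \<unlhd> q" "q \<unlhd> p"
  shows "r \<unlhd> p"
proof -
  obtain s s' where s: "reaches_in s r q" "reaches_in s' q p"
    using assms by (auto simp: le_def)
  obtain u where "\<And>z. z \<epsilon> u \<longleftrightarrow> z \<epsilon> s \<or> z \<epsilon> s'" using union2 by blast
  then show ?thesis
    unfolding le_def using s reaches_in_mono reaches_in_trans by metis
qed

lemma rel_imp_le: "a \<lhd> b \<Longrightarrow> a \<unlhd> b"
  unfolding le_def using reaches_in_step upair_ex by metis

text \<open>The elements of \<open>s\<close> reached from a predecessor of \<open>x\<close> in
  \<open>s\<close>, together with \<open>x\<close> itself, form a closed set; hence it contains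
  \<open>a\<close>.\<close>

lemma reaches_in_last_step:
  assumes "reaches_in s a x" "a \<noteq> x"
  shows "\<exists>y. y \<epsilon> s \<and> y \<lhd> x \<and> reaches_in s a y"
proof -
  have "definable (\<lambda>e. \<exists>y. y \<epsilon> s \<and> y \<lhd> x \<and> reaches_in s (e 0) y)"
    by (intro definable_intros definable_rel definable_reaches_in)
  then obtain v where
    v: "\<And>z. z \<epsilon> v \<longleftrightarrow> z \<epsilon> s \<and> (\<exists>y. y \<epsilon> s \<and> y \<lhd> x \<and> reaches_in s z y)"
    using separation[of "\<lambda>z. \<exists>y. y \<epsilon> s \<and> y \<lhd> x \<and> reaches_in s z y" s] by blast
  obtain t where t: "\<And>z. z \<epsilon> t \<longleftrightarrow> z = x \<or> z \<epsilon> v" using insert_ex by blast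
  have "c \<epsilon> t" if "b \<epsilon> t" "c \<epsilon> s" "c \<lhd> b" for b c
  proof -
    have "b = x \<or> (\<exists>y. y \<epsilon> s \<and> y \<lhd> x \<and> reaches_in s b y)" using that(1) t v by blast
    then have "\<exists>y. y \<epsilon> s \<and> y \<lhd> x \<and> reaches_in s c y"
      using that(2,3) reaches_in_refl reaches_in_step reaches_in_trans by metis
    then show ?thesis using t v that(2) by blast
  qed
  then have "a \<epsilon> t" using assms(1) t unfolding reaches_in_def by blast
  then show ?thesis using t v assms(2) by blast
qed

text \<open>Extends well-foundedness to sets not contained in \<open>X\<close>: only elements of
  \<open>X\<close> have predecessors or are predecessors.\<close>

lemma rel_minimal:
  assumes "x \<epsilon> s"
  shows "\<exists>m. m \<epsilon> s \<and> (\<forall>x. x \<epsilon> s \<longrightarrow> \<not> x \<lhd> m)"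
proof (cases "\<exists>x. x \<epsilon> s \<and> x \<in> X")
  case True
  have "definable (\<lambda>e. e 0 \<in> X)" by (intro definable_intros X_class)
  then obtain u where u: "\<And>z. z \<epsilon> u \<longleftrightarrow> z \<epsilon> s \<and> z \<in> X"
    using separation[of "\<lambda>z. z \<in> X" s] by blast
  have "well_founded_on E X (related E R)"
    using wf_relation by (simp add: well_founded_class_relation_def)
  then obtain m where "m \<epsilon> u \<and> (\<forall>x. x \<epsilon> u \<longrightarrow> \<not> x \<lhd> m)"
    unfolding well_founded_on_def using True u by metis
  then show ?thesis using u rel_in_X by blast
next
  case False
  then show ?thesis using assms rel_in_X by blast
qed

text \<open>If a set \<open>s\<close> had no minimal element, collecting one descent from each of its elements would
  give a set without a minimal element for the original relation.\<close>

lemma lt_minimal: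
  assumes "x \<epsilon> s"
  shows "\<exists>m. m \<epsilon> s \<and> (\<forall>x. x \<epsilon> s \<longrightarrow> \<not> x \<sqsubset> m)"
proof (rule ccontr)
  assume "\<not> ?thesis"
  then have desc: "\<exists>w a. a \<epsilon> s \<and> a \<noteq> b \<and> reaches_in w a b" if "b \<epsilon> s" for b
    using that unfolding lt_def le_def by blast
  have "definable (\<lambda>e. \<exists>a. a \<epsilon> s \<and> a \<noteq> e 0 \<and> reaches_in (e (Suc 0)) a (e 0))"
    by (intro definable_intros definable_reaches_in)
  from collection[OF this, of s] obtain W where
    W: "\<And>b. b \<epsilon> s \<Longrightarrow> \<exists>w. w \<epsilon> W \<and> (\<exists>a. a \<epsilon> s \<and> a \<noteq> b \<and> reaches_in w a b)"
    using desc by blast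
  \<comment> \<open>The union of the collected sets is one set within which every descent takes
    place.\<close>
  obtain u where u: "\<And>z. z \<epsilon> u \<longleftrightarrow> (\<exists>w. w \<epsilon> W \<and> z \<epsilon> w)"
    using union[of W] by blast
  have step: "\<exists>a. a \<epsilon> s \<and> a \<noteq> b \<and> reaches_in u a b" if "b \<epsilon> s" for b
    using W[OF that] u reaches_in_mono by metis
  obtain v where v: "\<And>z. z \<epsilon> v \<longleftrightarrow> z \<epsilon> u \<or> z \<epsilon> s" using union2 by blast
  have "definable (\<lambda>e. \<exists>a. a \<epsilon> s \<and> reaches_in u a (e 0))"
    by (intro definable_intros definable_reaches_in)
  then obtain B where B: "\<And>z. z \<epsilon> B \<longleftrightarrow> z \<epsilon> v \<and> (\<exists>a. a \<epsilon> s \<and> reaches_in u a z)"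
    using separation[of "\<lambda>z. \<exists>a. a \<epsilon> s \<and> reaches_in u a z" v] by blast
  have "x \<epsilon> B" using B v assms reaches_in_refl by blast
  then obtain m where m: "m \<epsilon> B" "\<And>y. y \<epsilon> B \<Longrightarrow> \<not> y \<lhd> m"
    using rel_minimal by blast
  \<comment> \<open>If the element of \<open>s\<close> reached from \<open>m\<close> is
    \<open>m\<close> itself, then \<open>m\<close> lies in \<open>s\<close> and \<open>step\<close>
    supplies another one.\<close>
  obtain a where a: "a \<epsilon> s" "a \<noteq> m" "reaches_in u a m"
    using m(1) B step by metis
  then obtain y where "y \<epsilon> u" "y \<lhd> m" "reaches_in u a y"
    using reaches_in_last_step by blast
  then show False using m(2) B v a(1) by blast
qed

text \<open>Otherwise the pair of \<open>p\<close> and \<open>q\<close> would have no minimal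
  element.\<close>

lemma le_antisym: "p \<unlhd> q \<Longrightarrow> q \<unlhd> p \<Longrightarrow> p = q"
  using lt_minimal upair_ex[of p q] unfolding lt_def by metis

lemma lt_trans: "p \<sqsubset> q \<Longrightarrow> q \<sqsubset> r \<Longrightarrow> p \<sqsubset> r"
  unfolding lt_def using le_trans le_antisym by blast

lemma le_lt_trans: "p \<unlhd> q \<Longrightarrow> q \<sqsubset> r \<Longrightarrow> p \<sqsubset> r"
  unfolding lt_def using le_trans le_antisym by blast

lemma lt_irrefl: "\<not> p \<sqsubset> p"
  by (simp add: lt_def)

lemma rel_imp_lt: "a \<lhd> b \<Longrightarrow> a \<sqsubset> b"
proof -
  assume "a \<lhd> b"
  moreover have "\<not> b \<lhd> b" using rel_minimal upair_ex[of b b] by metis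
  ultimately show ?thesis unfolding lt_def using rel_imp_le by blast
qed

section \<open>Greedy chains\<close>

text \<open>Going through the elements above \<open>x\<close> in the order \<open>\<prec>\<close>, the greedy chain of \<open>x\<close> takes each
  element that lies below all elements taken before.  A good set is an initial segment of this
  chain.\<close>

definition good :: "'a \<Rightarrow> 'a \<Rightarrow> bool" where
  "good t x \<longleftrightarrow> (\<forall>w. w \<epsilon> t \<longrightarrow> x \<unlhd> w \<and>
     (\<forall>v. x \<unlhd> v \<and> \<not> w \<prec> v \<longrightarrow> (v \<epsilon> t \<longleftrightarrow> (\<forall>v'. v' \<epsilon> t \<and> v' \<prec> v \<longrightarrow> v \<sqsubset> v'))))"

text \<open>A good set containing \<open>x\<close> is the complete chain, because by
  \<open>good_before\<close> none of its elements comes after \<open>x\<close>.\<close>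

definition chain :: "'a \<Rightarrow> 'a \<Rightarrow> bool" where
  "chain x u \<longleftrightarrow> (\<exists>t. good t x \<and> x \<epsilon> t \<and> u \<epsilon> t)"

lemma definable_good: "set_term s \<Longrightarrow> set_term t \<Longrightarrow> definable (\<lambda>e. good (s e) (t e))"
  by (rule definable_subst2[where Q = good])
    (unfold good_def, (intro definable_intros definable_le definable_lt definable_prec)+)

lemma definable_chain: "set_term s \<Longrightarrow> set_term t \<Longrightarrow> definable (\<lambda>e. chain (s e) (t e))"
  by (rule definable_subst2[where Q = chain])
    (unfold chain_def, (intro definable_intros definable_good)+)

lemma good_above: "good t x \<Longrightarrow> w \<epsilon> t \<Longrightarrow> x \<unlhd> w"
  unfolding good_def by blast

lemma good_descending: "good t x \<Longrightarrow> w \<epsilon> t \<Longrightarrow> v \<epsilon> t \<Longrightarrow> v \<prec> w \<Longrightarrow> w \<sqsubset> v"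
  unfolding good_def using prec_irrefl by blast

lemma good_greedy:
  "good t x \<Longrightarrow> w \<epsilon> t \<Longrightarrow> x \<unlhd> v \<Longrightarrow> \<not> w \<prec> v \<Longrightarrow> (\<And>v'. v' \<epsilon> t \<Longrightarrow> v' \<prec> v \<Longrightarrow> v \<sqsubset> v')
    \<Longrightarrow> v \<epsilon> t"
  unfolding good_def by blast

lemma good_before:
  assumes "good t x" "x \<epsilon> t" "w \<epsilon> t"
  shows "\<not> x \<prec> w"
  using good_descending[OF assms(1,3,2)] good_above[OF assms(1,3)] le_lt_trans lt_irrefl by blast

lemma good_extend:
  assumes t: "good t x" "u \<epsilon> t" "\<And>v. v \<epsilon> t \<Longrightarrow> \<not> u \<prec> v"
    and w: "x \<unlhd> w" "w \<sqsubset> u" "\<And>v. x \<unlhd> v \<and> v \<sqsubset> u \<Longrightarrow> \<not> v \<prec> w"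
    and t': "\<And>z. z \<epsilon> t' \<longleftrightarrow> z = w \<or> z \<epsilon> t"
  shows "good t' x" "u \<prec> w"
proof -
  have below: "w \<sqsubset> v" if "v \<epsilon> t" for v
    using that t good_descending w(2) lt_trans prec_total by metis
  have "\<not> w \<epsilon> t" using below lt_irrefl by blast
  then show uw: "u \<prec> w"
    using good_greedy[OF t(1,2) w(1)] below t(2) prec_total by blast
  show "good t' x"
    unfolding good_def
  proof (intro allI impI conjI)
    fix z assume z: "z \<epsilon> t'"
    then show "x \<unlhd> z" using t' w(1) good_above[OF t(1)] by metis
    fix v assume v: "x \<unlhd> v \<and> \<not> z \<prec> v"
    show "v \<epsilon> t' \<longleftrightarrow> (\<forall>v'. v' \<epsilon> t' \<and> v' \<prec> v \<longrightarrow> v \<sqsubset> v')"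
    \<comment> \<open>Up to \<open>u\<close> the new set behaves like \<open>t\<close>. Between
      \<open>u\<close> and \<open>w\<close> no element is below \<open>u\<close>, by the choice of
      \<open>w\<close>, so none is taken.\<close>
    proof (cases "u \<prec> v")
      case False
      have "\<not> w \<prec> v" "v \<noteq> w" using False uw prec_trans by blast+
      then show ?thesis
        using t' t(1,2) v False unfolding good_def by metis
    next
      case True
      have "z = w" using z t' t(3) v True prec_total prec_trans by metis
      then have "v = w \<or> v \<prec> w" using v prec_total by blast
      moreover have "\<not> v \<epsilon> t" using t(3) True by blast
      moreover have "\<not> v \<sqsubset> u" if "v \<prec> w" using that w(3) v by blast
      ultimately show ?thesis
        using t' below t(2) True prec_irrefl by metis
    qed
  qed
qed

text \<open>Consider the last elements of good sets. A \<open>\<sqsubset>\<close>-minimal one must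
  be \<open>x\<close>, for otherwise \<open>good_extend\<close> yields one strictly below it. This
  replaces a recursion along the chain.\<close>

lemma good_ex: "\<exists>t. good t x \<and> x \<epsilon> t"
proof -
  let ?K = "\<lambda>u. \<exists>t. good t x \<and> u \<epsilon> t \<and> (\<forall>v. v \<epsilon> t \<longrightarrow> \<not> u \<prec> v)"
  obtain i where "\<And>y. y \<epsilon> i \<longleftrightarrow> y \<prec> x" using prec_predecessors_set by blast
  then obtain j where j: "\<And>y. y \<epsilon> j \<longleftrightarrow> y = x \<or> y \<prec> x"
    using insert_ex[of x i] by auto
  have "definable (\<lambda>e. ?K (e 0))"
    by (intro definable_intros definable_good definable_prec)
  then obtain k where k: "\<And>u. u \<epsilon> k \<longleftrightarrow> u \<epsilon> j \<and> ?K u"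
    using separation[of ?K j] by blast
  \<comment> \<open>The first candidate does not come after \<open>x\<close>, since \<open>x\<close>
    is itself a candidate; so it stays inside the set \<open>j\<close>.\<close>
  have least: "\<exists>w. (x \<unlhd> w \<and> P w) \<and> (\<forall>v. x \<unlhd> v \<and> P v \<longrightarrow> \<not> v \<prec> w) \<and> w \<epsilon> j"
    if "definable (\<lambda>e. P (e 0))" "P x" for P
  proof -
    have "definable (\<lambda>e. x \<unlhd> e 0 \<and> P (e 0))"
      by (intro definable_intros definable_le that)
    then show ?thesis
      using prec_least[of "\<lambda>w. x \<unlhd> w \<and> P w" x] le_refl that(2) j prec_total by metis
  qed
  have "definable (\<lambda>e. e 0 = e 0)" by (intro definable_intros)
  then obtain p where p: "x \<unlhd> p" "\<And>v. x \<unlhd> v \<Longrightarrow> \<not> v \<prec> p" "p \<epsilon> j"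
    using least[of "\<lambda>z. z = z"] by blast
  obtain s where "\<And>z. z \<epsilon> s \<longleftrightarrow> z = p" using upair_ex[of p p] by auto
  \<comment> \<open>The first element above \<open>x\<close> alone forms a good set, so
    \<open>k\<close> is nonempty.\<close>
  with p have "good s x" "p \<epsilon> s" "\<And>v. v \<epsilon> s \<Longrightarrow> \<not> p \<prec> v"
    unfolding good_def using prec_total prec_irrefl by metis+
  with p(3) k have "p \<epsilon> k" by blast
  then obtain u where u: "u \<epsilon> k" "\<And>y. y \<epsilon> k \<Longrightarrow> \<not> y \<sqsubset> u" using lt_minimal by blast
  then obtain t where t: "good t x" "u \<epsilon> t" "\<And>v. v \<epsilon> t \<Longrightarrow> \<not> u \<prec> v" using k by blast
  show ?thesis
  proof (cases "u = x")
    case True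
    then show ?thesis using t by blast
  next
    case False
    then have "x \<sqsubset> u" using good_above[OF t(1,2)] by (auto simp: lt_def)
    moreover have "definable (\<lambda>e. e 0 \<sqsubset> u)" by (intro definable_intros definable_lt)
    ultimately obtain w where
      w: "x \<unlhd> w" "w \<sqsubset> u" "\<And>v. x \<unlhd> v \<and> v \<sqsubset> u \<Longrightarrow> \<not> v \<prec> w" "w \<epsilon> j"
      using least[of "\<lambda>w. w \<sqsubset> u"] by blast
    obtain t' where t': "\<And>z. z \<epsilon> t' \<longleftrightarrow> z = w \<or> z \<epsilon> t" using insert_ex by blast
    have "good t' x" "u \<prec> w" using good_extend[OF t w(1-3) t'] by blast+
    moreover have "\<not> w \<prec> v" if "v \<epsilon> t'" for v
      using that t' t(3) \<open>u \<prec> w\<close> prec_irrefl prec_trans by metis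
    ultimately have "w \<epsilon> k" using k w(4) t' by blast
    then show ?thesis using u(2) w(2) by blast
  qed
qed

text \<open>As \<open>d\<close> does not come after \<open>x\<close>, which belongs to
  \<open>t'\<close>, the greedy condition of \<open>t'\<close> decides \<open>d\<close>. It inspects
  only elements before \<open>d\<close>, where both sets agree.\<close>

lemma good_subset:
  assumes "good t x" "x \<epsilon> t" "good t' x" "x \<epsilon> t'" "d \<epsilon> t"
    and "\<And>v. v \<prec> d \<Longrightarrow> v \<epsilon> t \<longleftrightarrow> v \<epsilon> t'"
  shows "d \<epsilon> t'"
  using good_greedy[OF assms(3,4) good_above[OF assms(1,5)] good_before[OF assms(1,2,5)]]
    good_descending[OF assms(1,5)] assms(6) by blast

lemma good_unique:
  assumes "good t x" "x \<epsilon> t" "good t' x" "x \<epsilon> t'"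
  shows "t = t'"
proof (rule ccontr)
  assume "t \<noteq> t'"
  then obtain a where "\<not> (a \<epsilon> t \<longleftrightarrow> a \<epsilon> t')" using extensionality by blast
  moreover have "definable (\<lambda>e. \<not> (e 0 \<epsilon> t \<longleftrightarrow> e 0 \<epsilon> t'))" by (intro definable_intros)
  ultimately have "\<exists>d. \<not> (d \<epsilon> t \<longleftrightarrow> d \<epsilon> t') \<and> (\<forall>v. \<not> (v \<epsilon> t \<longleftrightarrow> v \<epsilon> t') \<longrightarrow> \<not> v \<prec> d)"
    by (rule prec_least[of "\<lambda>z. \<not> (z \<epsilon> t \<longleftrightarrow> z \<epsilon> t')", rotated])
  then obtain d where
    d: "\<not> (d \<epsilon> t \<longleftrightarrow> d \<epsilon> t')" "\<And>v. v \<prec> d \<Longrightarrow> v \<epsilon> t \<longleftrightarrow> v \<epsilon> t'"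
    by metis
  then show False using good_subset assms by metis
qed

section \<open>Properties of the complete greedy chain\<close>

lemma chain_set: "\<exists>t. good t x \<and> x \<epsilon> t \<and> (\<forall>u. chain x u \<longleftrightarrow> u \<epsilon> t)"
  using good_ex[of x] good_unique unfolding chain_def by blast

lemma chain_self: "chain x x"
  using chain_set by blast

lemma chain_above: "chain x u \<Longrightarrow> x \<unlhd> u"
  using chain_set good_above by blast

lemma chain_descending: "chain x w \<Longrightarrow> chain x v \<Longrightarrow> v \<prec> w \<Longrightarrow> w \<sqsubset> v"
  using chain_set[of x] good_descending by blast

lemma chain_before: "chain x w \<Longrightarrow> w = x \<or> w \<prec> x"
  using chain_set[of x] good_before prec_total by blast

lemma chain_greedy:
  assumes "x \<unlhd> v" "\<And>v'. chain x v' \<Longrightarrow> v' \<prec> v \<Longrightarrow> v \<sqsubset> v'"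
  shows "chain x v"
proof (cases "x \<prec> v")
  \<comment> \<open>The case is contradictory: \<open>x\<close> belongs to its own chain, so the
    hypothesis gives \<open>v \<sqsubset> x\<close>, against \<open>x \<unlhd> v\<close>.\<close>
  case True
  then show ?thesis using assms chain_self le_lt_trans lt_irrefl by blast
next
  case False
  then show ?thesis using assms chain_set[of x] good_greedy by metis
qed

section \<open>The lexicographic order of the greedy chains\<close>

text \<open>An extension of a chain precedes it, as in the Kleene-Brouwer order.\<close>

definition kb :: "'a \<Rightarrow> 'a \<Rightarrow> bool" where
  "kb x y \<longleftrightarrow>
     (\<exists>d. chain x d \<and> \<not> chain y d \<and> (\<forall>w. w \<prec> d \<longrightarrow> (chain x w \<longleftrightarrow> chain y w)))"

lemma definable_kb: "set_term s \<Longrightarrow> set_term t \<Longrightarrow> definable (\<lambda>e. kb (s e) (t e))"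
  by (rule definable_subst2[where Q = kb])
    (unfold kb_def, (intro definable_intros definable_chain definable_prec)+)

lemma kb_irrefl: "\<not> kb x x"
  by (auto simp: kb_def)

text \<open>The earlier of the two first differences witnesses the conclusion. They are distinct
  because the chain of \<open>y\<close> contains only the second.\<close>

lemma kb_trans:
  assumes "kb x y" "kb y z"
  shows "kb x z"
proof -
  obtain c where c: "chain x c" "\<not> chain y c" "\<And>w. w \<prec> c \<Longrightarrow> chain x w \<longleftrightarrow> chain y w"
    using assms(1) by (auto simp: kb_def)
  obtain d where d: "chain y d" "\<not> chain z d" "\<And>w. w \<prec> d \<Longrightarrow> chain y w \<longleftrightarrow> chain z w"
    using assms(2) by (auto simp: kb_def)
  consider "c \<prec> d" | "d \<prec> c" using c(2) d(1) prec_total by metis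
  then show ?thesis
  proof cases
    case 1
    then show ?thesis unfolding kb_def using c d prec_trans by (intro exI[of _ c]) metis
  next
    case 2
    then show ?thesis unfolding kb_def using c d prec_trans by (intro exI[of _ d]) metis
  qed
qed

lemma first_difference:
  assumes "x \<noteq> y"
  shows "\<exists>d. \<not> (chain x d \<longleftrightarrow> chain y d) \<and> (\<forall>w. w \<prec> d \<longrightarrow> (chain x w \<longleftrightarrow> chain y w))"
proof -
  \<comment> \<open>Equal chains would contain both \<open>x\<close> and \<open>y\<close>, placing
    each below the other.\<close>
  have "\<exists>d. \<not> (chain x d \<longleftrightarrow> chain y d)"
    using assms chain_self chain_above le_antisym by metis
  moreover have "definable (\<lambda>e. \<not> (chain x (e 0) \<longleftrightarrow> chain y (e 0)))"
    by (intro definable_intros definable_chain)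
  ultimately show ?thesis
    using prec_least[of "\<lambda>d. \<not> (chain x d \<longleftrightarrow> chain y d)"] by blast
qed

lemma kb_total: "x = y \<or> kb x y \<or> kb y x"
  using first_difference[of x y] unfolding kb_def by metis

text \<open>At the first difference \<open>d\<close>, if the chain of \<open>p\<close> takes
  \<open>d\<close>, then so does the chain of \<open>q\<close>, whose earlier elements are the same.
  Thus only the chain of \<open>q\<close> contains \<open>d\<close>.\<close>

lemma lt_imp_kb:
  assumes "q \<sqsubset> p"
  shows "kb q p"
proof -
  obtain d where d: "\<not> (chain q d \<longleftrightarrow> chain p d)" "\<And>w. w \<prec> d \<Longrightarrow> chain q w \<longleftrightarrow> chain p w"
    using first_difference[of q p] assms lt_irrefl by blast
  have "chain q d" if "chain p d"
  proof (rule chain_greedy)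
    show "q \<unlhd> d" using that assms chain_above le_trans unfolding lt_def by blast
    show "d \<sqsubset> v" if "chain q v" "v \<prec> d" for v
      using that \<open>chain p d\<close> chain_descending d(2) by blast
  qed
  then show ?thesis unfolding kb_def using d by blast
qed

text \<open>Eventually, as one descends in \<open>s\<close> along \<open>kb\<close>, the chains agree up to \<open>u\<close> and contain it.\<close>

definition stable :: "'a \<Rightarrow> 'a \<Rightarrow> bool" where
  "stable s u \<longleftrightarrow> (\<exists>x. x \<epsilon> s \<and> chain x u \<and>
     (\<forall>y. y \<epsilon> s \<and> \<not> kb x y \<longrightarrow> (\<forall>w. \<not> u \<prec> w \<longrightarrow> (chain y w \<longleftrightarrow> chain x w))))"

text \<open>Among the elements outside \<open>I\<close> of chains of members of \<open>s\<close> not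
  after \<open>x\<close>, the \<open>\<prec>\<close>-first one is stable. \<open>I\<close> collects
  the part on which these chains already agree.\<close>

lemma stable_step:
  assumes "x \<epsilon> s" "definable (\<lambda>e. I (e 0))"
    and agree: "\<And>y w. y \<epsilon> s \<Longrightarrow> \<not> kb x y \<Longrightarrow> I w \<Longrightarrow> chain y w \<longleftrightarrow> chain x w"
    and next_elt: "y \<epsilon> s" "\<not> kb x y" "chain y w" "\<not> I w"
  shows "\<exists>z w. z \<epsilon> s \<and> \<not> kb x z \<and> chain z w \<and> \<not> I w \<and> stable s w"
proof -
  let ?P = "\<lambda>w. \<not> I w \<and> (\<exists>y. y \<epsilon> s \<and> \<not> kb x y \<and> chain y w)"
  have "definable (\<lambda>e. ?P (e 0))"
    by (intro definable_intros definable_kb definable_chain assms(2))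
  then obtain w z where w: "\<not> I w" "z \<epsilon> s" "\<not> kb x z" "chain z w" "\<And>v. ?P v \<Longrightarrow> \<not> v \<prec> w"
    using prec_least[of ?P w] next_elt by blast
  have "chain y v \<longleftrightarrow> chain z v" if y: "y \<epsilon> s" "\<not> kb z y" "\<not> w \<prec> v" for y v
  proof -
    have xy: "\<not> kb x y" using y(2) w(3) kb_total kb_trans by metis
    \<comment> \<open>For \<open>v\<close> in \<open>I\<close> both chains agree with that of
      \<open>x\<close>; for \<open>v\<close> outside \<open>I\<close> neither contains it, by the
      choice of \<open>w\<close>.\<close>
    have before: "chain y v \<longleftrightarrow> chain z v" if "v \<prec> w" for v
      using agree w y(1) xy that by blast
    \<comment> \<open>Otherwise \<open>w\<close> would be the first difference and
      \<open>kb z y\<close> would hold.\<close>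
    have "chain y w" using y(2) w(4) before unfolding kb_def by blast
    then show ?thesis using before w(4) y(3) prec_total by metis
  qed
  then have "stable s w" unfolding stable_def using w by blast
  then show ?thesis using w by blast
qed

lemma kb_minimal:
  assumes "a \<epsilon> s"
  shows "\<exists>m. m \<epsilon> s \<and> (\<forall>x. x \<epsilon> s \<longrightarrow> \<not> kb x m)"
proof (rule ccontr)
  assume "\<not> ?thesis"
  then have desc: "\<exists>y. y \<epsilon> s \<and> kb y x" if "x \<epsilon> s" for x using that by blast
  \<comment> \<open>Each chain lies in the initial segment up to its own element. Collecting these
    segments for the elements of \<open>s\<close> bounds all stable elements by a set, so
    \<open>lt_minimal\<close> applies to them.\<close>
  let ?I = "\<lambda>x i. \<forall>y. y \<epsilon> i \<longleftrightarrow> y \<prec> x \<or> y = x"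
  have initial: "\<exists>i. ?I x i" for x
    using prec_predecessors_set[of x] insert_ex[of x] by metis
  have "definable (\<lambda>e. ?I (e 0) (e (Suc 0)))" by (intro definable_intros definable_prec)
  then obtain U where U: "\<And>x. x \<epsilon> s \<Longrightarrow> \<exists>i. i \<epsilon> U \<and> ?I x i"
    using collection[of ?I s] initial by blast
  obtain u where u: "\<And>z. z \<epsilon> u \<longleftrightarrow> (\<exists>i. i \<epsilon> U \<and> z \<epsilon> i)" using union[of U] by blast
  have "definable (\<lambda>e. stable s (e 0))"
    unfolding stable_def
    by (intro definable_intros definable_kb definable_chain definable_prec)
  then obtain k where "\<And>z. z \<epsilon> k \<longleftrightarrow> z \<epsilon> u \<and> stable s z"
    using separation[of "stable s" u] by blast
  moreover have "z \<epsilon> u" if "stable s z" for z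
    using that U u chain_before unfolding stable_def by metis
  ultimately have k: "\<And>z. z \<epsilon> k \<longleftrightarrow> stable s z" by blast
  \<comment> \<open>With \<open>I\<close> empty, \<open>stable_step\<close> gives a first stable
    element.\<close>
  have "definable (\<lambda>e. e 0 \<noteq> e 0)" by (intro definable_intros)
  then have "\<exists>w. stable s w"
    using stable_step[of a s "\<lambda>w. w \<noteq> w" a a] assms kb_irrefl chain_self by auto
  then obtain m where m: "stable s m" "\<And>y. stable s y \<Longrightarrow> \<not> y \<sqsubset> m"
    using lt_minimal k by metis
  obtain x where x: "x \<epsilon> s" "chain x m"
    "\<And>y w. y \<epsilon> s \<Longrightarrow> \<not> kb x y \<Longrightarrow> \<not> m \<prec> w \<Longrightarrow> chain y w \<longleftrightarrow> chain x w"
    using m(1) unfolding stable_def by blast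
  \<comment> \<open>Either \<open>x\<close> itself or, if \<open>x = m\<close>, an element strictly
    before it. Its chain contains \<open>m\<close> and ends at \<open>y\<close>, hence goes past
    \<open>m\<close>.\<close>
  obtain y where y: "y \<epsilon> s" "\<not> kb x y" "y \<noteq> m"
    using desc x(1) kb_irrefl kb_trans by metis
  have ym: "chain y m" using x y prec_irrefl by blast
  have "\<not> y \<prec> m"
    using chain_descending[OF ym chain_self] chain_above[OF ym] le_lt_trans lt_irrefl by blast
  then have my: "m \<prec> y" using y(3) prec_total by blast
  \<comment> \<open>With \<open>I\<close> the initial segment up to \<open>m\<close>,
    \<open>stable_step\<close> gives a stable \<open>w\<close> after \<open>m\<close>. It shares a
    chain with \<open>m\<close>, so \<open>w \<sqsubset> m\<close>, against minimality.\<close>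
  have "definable (\<lambda>e. \<not> m \<prec> e 0)" by (intro definable_intros definable_prec)
  then have "\<exists>z w. z \<epsilon> s \<and> \<not> kb x z \<and> chain z w \<and> \<not> \<not> m \<prec> w \<and> stable s w"
    by (rule stable_step[where I = "\<lambda>w. \<not> m \<prec> w", OF x(1) _ x(3) y(1,2) chain_self])
      (use my in simp_all)
  then obtain z w where "z \<epsilon> s" "\<not> kb x z" "chain z w" "m \<prec> w" "stable s w"
    by blast
  moreover from this have "chain z m" using x prec_irrefl by blast
  ultimately show False using chain_descending m(2) by blast
qed

section \<open>The identity as a ranking into the universe ordered by \<open>kb\<close>\<close>

lemma ranking_ex: "\<exists>\<Gamma> L. class_well_order E Cls \<Gamma> L \<and> (\<exists>\<pi>. ranking E Cls X R \<Gamma> L \<pi>)"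
proof -
  let ?L = "graph_class E (\<lambda>a b. a = b \<or> kb a b)"
  let ?\<pi> = "graph_class E (\<lambda>a b. a = b \<and> a \<in> X)"
  have "definable (\<lambda>e. e 0 = e 0)" by (intro definable_intros)
  then have UNIV_class: "UNIV \<in> Cls" using definable_class[of "\<lambda>x. x = x"] by simp
  have L: "?L \<in> Cls"
    by (intro graph_class_in_Cls definable_intros definable_kb)
  have \<pi>: "?\<pi> \<in> Cls"
    by (intro graph_class_in_Cls definable_intros X_class)
  have strict: "strictly_related E ?L a b \<longleftrightarrow> kb a b" for a b
    using kb_irrefl by (auto simp: strictly_related_def)
  have "class_linear_order E Cls UNIV ?L"
    unfolding class_linear_order_def binary_class_relation_def
  proof (intro conjI UNIV_class L)
    show "within_product E UNIV UNIV ?L"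
      by (auto simp: within_product_def graph_class_def)
    show "reflp_on UNIV (related E ?L)" by (simp add: reflp_on_def)
    show "antisymp_on UNIV (related E ?L)"
      using kb_irrefl kb_trans by (auto simp: antisymp_on_def)
    show "transp_on UNIV (related E ?L)"
      using kb_trans by (auto simp: transp_on_def)
    show "totalp_on UNIV (related E ?L)"
      using kb_total by (auto simp: totalp_on_def)
  qed
  moreover have "well_founded_on E UNIV (strictly_related E ?L)"
    using kb_minimal by (auto simp: well_founded_on_def strict)
  ultimately have "class_well_order E Cls UNIV ?L" by (simp add: class_well_order_def)
  moreover have "within_product E X UNIV ?\<pi>"
    by (auto simp: within_product_def graph_class_def)
  then have "ranking E Cls X R UNIV ?L ?\<pi>"
    unfolding ranking_def class_map_def using \<pi> lt_imp_kb rel_imp_lt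
    by (auto simp: strict Ex1_def)
  ultimately show ?thesis by blast
qed

end

theorem theorem4:
  fixes E :: "'s \<Rightarrow> 's \<Rightarrow> bool"
    and Cls :: "'s set set"
    and X R :: "'s set"
  assumes "GBC_minus E Cls"
    and "well_founded_class_relation E Cls X R"
  shows "\<exists>\<Gamma> L. class_well_order E Cls \<Gamma> L \<and> (\<exists>\<pi>. ranking E Cls X R \<Gamma> L \<pi>)"
proof -
  obtain F where "class_bijection E Cls UNIV {x. is_ordinal E x} F"
    using GBC_minus.global_choice[OF assms(1)] by blast
  with assms interpret GBC_relation E Cls F X R
    by (simp add: GBC_relation_def GBC_relation_axioms_def GBC_enumeration_def
        GBC_enumeration_axioms_def)
  show ?thesis by (rule ranking_ex)
qed

end
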